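(* Let $X$ be a real algebraic variety. For any complex subvariety $V\subset\mathbb{C}X$, the intersection $V\cap\mathbb{R}X$ is the set of real points of a real algebraic subvariety of $X$.
   Context: A real algebraic variety $X$ consists of the set $\mathbb{C}X$ of its complex points (a complex algebraic variety), an anti-holomorphic involution $\mathrm{conj}:\mathbb{C}X\to\mathbb{C}X$ (the complex conjugation, which maps complex algebraic subvarieties to complex algebraic subvarieties), and the set $\mathbb{R}X=\mathrm{Fix}(\mathrm{conj})$ of real points. A real algebraic subvariety $Y$ of $X$ is given by a complex algebraic subvariety $\mathbb{C}Y\subset\mathbb{C}X$ invariant under $\mathrm{conj}$; its set of real points is $\mathbb{R}Y=\mathbb{C}Y\cap\mathbb{R}X$. Complex subvarieties are (closed) complex algebraic subvarieties. *)

theory Defs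
  imports "HOL-Analysis.Analysis"
begin

section \<open>Affine algebraic sets over the complex numbers\<close>

text \<open>
  The points of complex \<open>n\<close>-space are the functions in \<open>{..<n} \<rightarrow>\<^sub>E UNIV\<close>, which is the
  carrier of the product topology \<open>complex_space n\<close>, that is, of the Euclidean topology.
\<close>

abbreviation complex_space :: "nat \<Rightarrow> (nat \<Rightarrow> complex) topology" where
  "complex_space n \<equiv> product_topology (\<lambda>_. euclidean) {..<n}"

inductive_set poly_functions :: "nat \<Rightarrow> ((nat \<Rightarrow> complex) \<Rightarrow> complex) set" for n :: nat where
  const: "(\<lambda>_. c) \<in> poly_functions n"
| coord: "i < n \<Longrightarrow> (\<lambda>z. z i) \<in> poly_functions n"
| add: "p \<in> poly_functions n \<Longrightarrow> q \<in> poly_functions n \<Longrightarrow> (\<lambda>z. p z + q z) \<in> poly_functions n"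
| mult: "p \<in> poly_functions n \<Longrightarrow> q \<in> poly_functions n \<Longrightarrow> (\<lambda>z. p z * q z) \<in> poly_functions n"

definition algebraic_set :: "nat \<Rightarrow> (nat \<Rightarrow> complex) set \<Rightarrow> bool" where
  "algebraic_set n Z \<longleftrightarrow>
     (\<exists>S \<subseteq> poly_functions n. Z = {z \<in> {..<n} \<rightarrow>\<^sub>E UNIV. \<forall>p\<in>S. p z = 0})"

definition affine_zariski :: "nat \<Rightarrow> (nat \<Rightarrow> complex) set \<Rightarrow> (nat \<Rightarrow> complex) topology" where
  "affine_zariski n Z =
     topology (\<lambda>U. \<exists>S \<subseteq> poly_functions n. U = Z - {z. \<forall>p\<in>S. p z = 0})"

lemma openin_affine_zariski:
  "openin (affine_zariski n Z) U \<longleftrightarrow>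
     (\<exists>S \<subseteq> poly_functions n. U = Z - {z. \<forall>p\<in>S. p z = 0})"
proof -
  let ?P = "\<lambda>U. \<exists>S \<subseteq> poly_functions n. U = Z - {z. \<forall>p\<in>S. p z = 0}"
  have "?P (U \<inter> V)" if "?P U" "?P V" for U V
  proof -
    from that obtain S T where S: "S \<subseteq> poly_functions n" "U = Z - {z. \<forall>p\<in>S. p z = 0}"
      and T: "T \<subseteq> poly_functions n" "V = Z - {z. \<forall>p\<in>T. p z = 0}" by blast
    let ?R = "(\<lambda>(p, q) z. p z * q z) ` (S \<times> T)"
    have "?R \<subseteq> poly_functions n" using S T by (auto intro: poly_functions.mult)
    moreover have "U \<inter> V = Z - {z. \<forall>p\<in>?R. p z = 0}"
    proof (intro set_eqI iffI)
      fix z assume "z \<in> U \<inter> V"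
      then obtain p q where "z \<in> Z" "p \<in> S" "q \<in> T" "p z \<noteq> 0" "q z \<noteq> 0"
        using S T by auto
      then show "z \<in> Z - {z. \<forall>p\<in>?R. p z = 0}"
        by force
    qed (use S T in auto)
    ultimately show ?thesis by blast
  qed
  moreover have "?P (\<Union>K)" if K: "\<forall>U\<in>K. ?P U" for K
  proof -
    from bchoice[OF K] obtain S where
      S: "\<forall>U\<in>K. S U \<subseteq> poly_functions n \<and> U = Z - {z. \<forall>p\<in>S U. p z = 0}" by blast
    have "\<Union>K = Z - {z. \<forall>p\<in>\<Union>(S ` K). p z = 0}"
    proof (intro set_eqI iffI)
      fix z assume "z \<in> \<Union>K"
      then obtain U where "U \<in> K" "z \<in> U" by blast
      then show "z \<in> Z - {z. \<forall>p\<in>\<Union>(S ` K). p z = 0}" using S by blast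
    next
      fix z assume "z \<in> Z - {z. \<forall>p\<in>\<Union>(S ` K). p z = 0}"
      then obtain U p where "z \<in> Z" "U \<in> K" "p \<in> S U" "p z \<noteq> 0" by blast
      then show "z \<in> \<Union>K" using S by blast
    qed
    with S show ?thesis by (intro exI[of _ "\<Union>(S ` K)"]) blast
  qed
  ultimately have "istopology ?P" unfolding istopology_def by blast
  then show ?thesis by (simp add: affine_zariski_def topology_inverse')
qed


section \<open>Complex algebraic varieties\<close>

text \<open>
  A complex algebraic variety is described by its Zariski topology, whose carrier is the set of
  complex points, and by the sheaf \<open>regular\<close> of complex-valued functions. A function on \<open>U\<close> is
  represented by any total function that restricts to it.
\<close>

record 'a function_space =
  zariski :: "'a topology"
  regular :: "'a set \<Rightarrow> ('a \<Rightarrow> complex) set"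

abbreviation points :: "('a, 'b) function_space_scheme \<Rightarrow> 'a set" where
  "points X \<equiv> topspace (zariski X)"

definition ringed_space :: "'a function_space \<Rightarrow> bool" where
  "ringed_space X \<longleftrightarrow>
     (\<forall>U. openin (zariski X) U \<longrightarrow>
        (\<forall>f g. f \<in> regular X U \<and> (\<forall>x\<in>U. g x = f x) \<longrightarrow> g \<in> regular X U) \<and>
        (\<forall>c. (\<lambda>_. c) \<in> regular X U) \<and>
        (\<forall>f g. f \<in> regular X U \<and> g \<in> regular X U \<longrightarrow>
           (\<lambda>x. f x + g x) \<in> regular X U \<and> (\<lambda>x. f x * g x) \<in> regular X U) \<and>
        (\<forall>f N. f \<in> regular X U \<and> openin (zariski X) N \<and> N \<subseteq> U \<longrightarrow> f \<in> regular X N) \<and>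
        (\<forall>f. (\<forall>x\<in>U. \<exists>N. openin (zariski X) N \<and> x \<in> N \<and> N \<subseteq> U \<and> f \<in> regular X N)
             \<longrightarrow> f \<in> regular X U))"

definition morphism :: "'a function_space \<Rightarrow> 'b function_space \<Rightarrow> ('a \<Rightarrow> 'b) \<Rightarrow> bool" where
  "morphism X Y \<phi> \<longleftrightarrow>
     continuous_map (zariski X) (zariski Y) \<phi> \<and>
     (\<forall>W f. openin (zariski Y) W \<and> f \<in> regular Y W \<longrightarrow>
        f \<circ> \<phi> \<in> regular X {x \<in> points X. \<phi> x \<in> W})"

definition isomorphic :: "'a function_space \<Rightarrow> 'b function_space \<Rightarrow> bool" where
  "isomorphic X Y \<longleftrightarrow>
     (\<exists>\<phi> \<psi>. morphism X Y \<phi> \<and> morphism Y X \<psi> \<and>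
        (\<forall>x\<in>points X. \<psi> (\<phi> x) = x) \<and> (\<forall>y\<in>points Y. \<phi> (\<psi> y) = y))"

definition open_subspace :: "'a function_space \<Rightarrow> 'a set \<Rightarrow> 'a function_space" where
  "open_subspace X U = \<lparr>zariski = subtopology (zariski X) U, regular = regular X\<rparr>"

text \<open>Regular functions on an affine algebraic set are locally quotients of polynomials.\<close>

definition affine_variety :: "nat \<Rightarrow> (nat \<Rightarrow> complex) set \<Rightarrow> (nat \<Rightarrow> complex) function_space" where
  "affine_variety n Z =
     \<lparr>zariski = affine_zariski n Z,
      regular = (\<lambda>U. {f. \<forall>z\<in>U. \<exists>N p q. openin (affine_zariski n Z) N \<and> z \<in> N \<and> N \<subseteq> U \<and>
        p \<in> poly_functions n \<and> q \<in> poly_functions n \<and>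
        (\<forall>w\<in>N. q w \<noteq> 0 \<and> f w = p w / q w)})\<rparr>"

definition algebraic_prevariety :: "'a function_space \<Rightarrow> bool" where
  "algebraic_prevariety X \<longleftrightarrow>
     ringed_space X \<and> compact_space (zariski X) \<and>
     (\<forall>x\<in>points X. \<exists>U n Z. openin (zariski X) U \<and> x \<in> U \<and> algebraic_set n Z \<and>
        isomorphic (open_subspace X U) (affine_variety n Z))"

text \<open>
  Separatedness is expressed by testing on affine varieties; this is equivalent to the diagonal
  being closed in the product variety. Varieties need not be irreducible, and may be empty.
\<close>

definition algebraic_variety :: "'a function_space \<Rightarrow> bool" where
  "algebraic_variety X \<longleftrightarrow>
     algebraic_prevariety X \<and>
     (\<forall>n Z \<phi> \<psi>. algebraic_set n Z \<and> morphism (affine_variety n Z) X \<phi> \<and>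
        morphism (affine_variety n Z) X \<psi> \<longrightarrow>
        closedin (affine_zariski n Z) {z \<in> Z. \<phi> z = \<psi> z})"

text \<open>
  A closed subvariety is a Zariski closed set of points, with its reduced structure; like
  varieties, subvarieties may be reducible or empty.
\<close>

definition complex_subvariety :: "'a function_space \<Rightarrow> 'a set \<Rightarrow> bool" where
  "complex_subvariety X V \<longleftrightarrow> closedin (zariski X) V"


section \<open>The underlying complex analytic structure\<close>

text \<open>
  Holomorphic functions of \<open>n\<close> variables are continuous functions that are holomorphic in each
  variable separately.
\<close>

definition holomorphic_several ::
    "nat \<Rightarrow> (nat \<Rightarrow> complex) set \<Rightarrow> ((nat \<Rightarrow> complex) \<Rightarrow> complex) \<Rightarrow> bool" where
  "holomorphic_several n D h \<longleftrightarrow>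
     openin (complex_space n) D \<and>
     continuous_map (subtopology (complex_space n) D) euclidean h \<and>
     (\<forall>z\<in>D. \<forall>i<n. (\<lambda>w. h (z(i := w))) field_differentiable at (z i))"

text \<open>
  The classical topology is the coarsest one for which Zariski open sets are open and regular
  functions are continuous. In an affine chart it is the Euclidean topology.
\<close>

definition analytic_topology :: "'a function_space \<Rightarrow> 'a topology" where
  "analytic_topology X =
     topology_generated_by
       {{x \<in> U. f x \<in> D} | U f D. openin (zariski X) U \<and> f \<in> regular X U \<and> open D}"

text \<open>
  A function on an analytic open set is holomorphic if it is locally a holomorphic function of
  finitely many regular functions. In an affine chart this says that it is locally the restriction
  of a holomorphic function on the ambient space.
\<close>

definition holomorphic_functions :: "'a function_space \<Rightarrow> 'a set \<Rightarrow> ('a \<Rightarrow> complex) set" where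
  "holomorphic_functions X W =
     {g. \<forall>x\<in>W. \<exists>N U n F D h.
        openin (analytic_topology X) N \<and> x \<in> N \<and> N \<subseteq> W \<and>
        openin (zariski X) U \<and> N \<subseteq> U \<and> (\<forall>i<n. F i \<in> regular X U) \<and>
        holomorphic_several n D h \<and>
        (\<forall>y\<in>N. (\<lambda>i\<in>{..<n}. F i y) \<in> D \<and> g y = h (\<lambda>i\<in>{..<n}. F i y))}"

definition antiholomorphic_map ::
    "'a function_space \<Rightarrow> 'b function_space \<Rightarrow> ('a \<Rightarrow> 'b) \<Rightarrow> bool" where
  "antiholomorphic_map X Y \<phi> \<longleftrightarrow>
     continuous_map (analytic_topology X) (analytic_topology Y) \<phi> \<and>
     (\<forall>W g. openin (analytic_topology Y) W \<and> g \<in> holomorphic_functions Y W \<longrightarrow>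
        (\<lambda>x. cnj (g (\<phi> x))) \<in> holomorphic_functions X {x \<in> points X. \<phi> x \<in> W})"


section \<open>Real algebraic varieties\<close>

definition real_algebraic_variety :: "'a function_space \<Rightarrow> ('a \<Rightarrow> 'a) \<Rightarrow> bool" where
  "real_algebraic_variety X \<sigma> \<longleftrightarrow>
     algebraic_variety X \<and>
     (\<forall>x\<in>points X. \<sigma> x \<in> points X \<and> \<sigma> (\<sigma> x) = x) \<and>
     antiholomorphic_map X X \<sigma> \<and>
     (\<forall>V. complex_subvariety X V \<longrightarrow> complex_subvariety X (\<sigma> ` V))"

definition real_points :: "'a function_space \<Rightarrow> ('a \<Rightarrow> 'a) \<Rightarrow> 'a set" where
  "real_points X \<sigma> = {x \<in> points X. \<sigma> x = x}"

text \<open>A real subvariety is given by the set \<open>Y\<close> of its complex points.\<close>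

definition real_subvariety :: "'a function_space \<Rightarrow> ('a \<Rightarrow> 'a) \<Rightarrow> 'a set \<Rightarrow> bool" where
  "real_subvariety X \<sigma> Y \<longleftrightarrow> complex_subvariety X Y \<and> \<sigma> ` Y = Y"

definition subvariety_real_points :: "'a function_space \<Rightarrow> ('a \<Rightarrow> 'a) \<Rightarrow> 'a set \<Rightarrow> 'a set" where
  "subvariety_real_points X \<sigma> Y = Y \<inter> real_points X \<sigma>"

end

theory Submission
  imports Defs
begin

text \<open>
  A real point of \<open>V\<close> is fixed by the conjugation \<open>\<sigma>\<close>, hence lies in \<open>\<sigma> ` V\<close> as well. So cutting
  \<open>V\<close> down to \<open>V \<inter> \<sigma> ` V\<close> loses no real points, and this intersection is closed, because \<open>\<sigma>\<close>
  maps subvarieties to subvarieties, and invariant, because the involution \<open>\<sigma>\<close> swaps its two parts.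
\<close>

theorem theorem2:
  fixes X :: "'a function_space" and \<sigma> :: "'a \<Rightarrow> 'a" and V :: "'a set"
  assumes "real_algebraic_variety X \<sigma>"
    and "complex_subvariety X V"
  shows "\<exists>Y. real_subvariety X \<sigma> Y \<and> V \<inter> real_points X \<sigma> = subvariety_real_points X \<sigma> Y"
proof (intro exI conjI)
  let ?Y = "V \<inter> \<sigma> ` V"
  have "V \<subseteq> points X"
    using assms(2) unfolding complex_subvariety_def by (rule closedin_subset)
  with assms(1) have involution: "\<sigma> (\<sigma> x) = x" if "x \<in> V" for x
    using that unfolding real_algebraic_variety_def by blast
  have "complex_subvariety X (\<sigma> ` V)"
    using assms unfolding real_algebraic_variety_def by blast
  with assms(2) have "complex_subvariety X ?Y"
    unfolding complex_subvariety_def by (rule closedin_Int)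
  moreover have "\<sigma> ` ?Y = ?Y"
  proof
    show invariant: "\<sigma> ` ?Y \<subseteq> ?Y" using involution by auto
    show "?Y \<subseteq> \<sigma> ` ?Y"
    proof
      fix x assume "x \<in> ?Y"
      with invariant involution have "\<sigma> x \<in> ?Y" "x = \<sigma> (\<sigma> x)" by auto
      then show "x \<in> \<sigma> ` ?Y" by (rule rev_image_eqI)
    qed
  qed
  ultimately show "real_subvariety X \<sigma> ?Y" unfolding real_subvariety_def ..
  show "V \<inter> real_points X \<sigma> = subvariety_real_points X \<sigma> ?Y"
    unfolding subvariety_real_points_def real_points_def by force
qed

end
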